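(* For all formulas $A_1,\ldots,A_m,B$ of 3-valued Łukasiewicz logic: if there is an $\mathcal{H}\text{Łuk}$ derivation of $B$ from $A_1,\ldots,A_m$ in $n$ steps, then there are $\mathcal{H}\text{Łuk}$ proofs in $O(m+n)$ steps of $A_1\supset(A_1\supset(\ldots\supset(A_m\supset(A_m\supset B))))$ and of $(\neg(A_1\supset\neg A_1)\wedge\ldots\wedge\neg(A_m\supset\neg A_m))\supset B$, where the conjunction is associated arbitrarily.
   Context: Formulas are built from propositional variables with $\wedge,\vee,\supset,\neg$. $\mathcal{H}\text{Łuk}$ (Avron's Frege system for 3-valued Łukasiewicz logic) has the axiom schemas: (1) $A\supset(B\supset A)$; (2) $(A\supset B)\supset((B\supset C)\supset(A\supset C))$; (3) $((A\supset B)\supset B)\supset((B\supset A)\supset A)$; (4) $((((A\supset B)\supset A)\supset A)\supset(B\supset C))\supset(B\supset C)$; (5) $(A\wedge B)\supset A$; (6) $(A\wedge B)\supset B$; (7) $(A\supset B)\supset((A\supset C)\supset(A\supset(B\wedge C)))$; (8) $A\supset(A\vee B)$; (9) $B\supset(A\vee B)$; (10) $(A\supset C)\supset((B\supset C)\supset((A\vee B)\supset C))$; (11) $(\neg B\supset\neg A)\supset(A\supset B)$; its only rule is modus ponens. A derivation of $B$ from a set $\Gamma$ is a finite sequence of formulas ending in $B$, each an axiom instance, a member of $\Gamma$, or obtained from two earlier ones by modus ponens; a proof is a derivation from $\emptyset$; steps = length of the sequence. *)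

theory Defs
  imports Main
begin

datatype 'v fm =
    Var 'v
  | Neg "'v fm"  (\<open>\<^bold>\<not> _\<close> [90] 90)
  | Conj "'v fm" "'v fm"  (infixr \<open>\<^bold>\<and>\<close> 80)
  | Disj "'v fm" "'v fm"  (infixr \<open>\<^bold>\<or>\<close> 75)
  | Impl "'v fm" "'v fm"  (infixr \<open>\<^bold>\<supset>\<close> 70)

inductive HLuk_axiom :: "'v fm \<Rightarrow> bool" where
  ax1: "HLuk_axiom (A \<^bold>\<supset> (B \<^bold>\<supset> A))"
| ax2: "HLuk_axiom ((A \<^bold>\<supset> B) \<^bold>\<supset> ((B \<^bold>\<supset> C) \<^bold>\<supset> (A \<^bold>\<supset> C)))"
| ax3: "HLuk_axiom (((A \<^bold>\<supset> B) \<^bold>\<supset> B) \<^bold>\<supset> ((B \<^bold>\<supset> A) \<^bold>\<supset> A))"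
| ax4: "HLuk_axiom (((((A \<^bold>\<supset> B) \<^bold>\<supset> A) \<^bold>\<supset> A) \<^bold>\<supset> (B \<^bold>\<supset> C)) \<^bold>\<supset> (B \<^bold>\<supset> C))"
| ax5: "HLuk_axiom ((A \<^bold>\<and> B) \<^bold>\<supset> A)"
| ax6: "HLuk_axiom ((A \<^bold>\<and> B) \<^bold>\<supset> B)"
| ax7: "HLuk_axiom ((A \<^bold>\<supset> B) \<^bold>\<supset> ((A \<^bold>\<supset> C) \<^bold>\<supset> (A \<^bold>\<supset> (B \<^bold>\<and> C))))"
| ax8: "HLuk_axiom (A \<^bold>\<supset> (A \<^bold>\<or> B))"
| ax9: "HLuk_axiom (B \<^bold>\<supset> (A \<^bold>\<or> B))"
| ax10: "HLuk_axiom ((A \<^bold>\<supset> C) \<^bold>\<supset> ((B \<^bold>\<supset> C) \<^bold>\<supset> ((A \<^bold>\<or> B) \<^bold>\<supset> C)))"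
| ax11: "HLuk_axiom ((\<^bold>\<not> B \<^bold>\<supset> \<^bold>\<not> A) \<^bold>\<supset> (A \<^bold>\<supset> B))"

definition HLuk_derivation :: "'v fm set \<Rightarrow> 'v fm list \<Rightarrow> 'v fm \<Rightarrow> bool" where
  "HLuk_derivation \<Gamma> d B \<longleftrightarrow>
     d \<noteq> [] \<and> last d = B \<and>
     (\<forall>i < length d.
        HLuk_axiom (d ! i) \<or> d ! i \<in> \<Gamma> \<or>
        (\<exists>j < i. \<exists>k < i. d ! k = (d ! j \<^bold>\<supset> d ! i)))"

definition HLuk_proof :: "'v fm list \<Rightarrow> 'v fm \<Rightarrow> bool" where
  "HLuk_proof p B \<longleftrightarrow> HLuk_derivation {} p B"

fun double_impl :: "'v fm list \<Rightarrow> 'v fm \<Rightarrow> 'v fm" where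
  "double_impl [] B = B"
| "double_impl (A # As) B = (A \<^bold>\<supset> (A \<^bold>\<supset> double_impl As B))"

text \<open>\<open>assoc_conj Cs D\<close>: the formula \<open>D\<close> is the conjunction of the members of \<open>Cs\<close>, in this
  order, for some way of placing the parentheses. No \<open>D\<close> qualifies if \<open>Cs\<close> is empty.\<close>

inductive assoc_conj :: "'v fm list \<Rightarrow> 'v fm \<Rightarrow> bool" where
  single: "assoc_conj [C] C"
| conj: "assoc_conj Cs C \<Longrightarrow> assoc_conj Ds D \<Longrightarrow> assoc_conj (Cs @ Ds) (C \<^bold>\<and> D)"

end

theory Submission
  imports Defs
begin

text \<open>
  Write \<open>sq A\<close> for \<open>\<not>(A \<supset> \<not>A)\<close>, which only takes the values 0 and 1. A conjunction \<open>D\<close> of such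
  formulas is again two-valued, and \<open>D \<or> \<not>D\<close> is provable with a bounded number of steps per
  conjunct. Excluded middle for \<open>D\<close> yields contraction, hence modus ponens under the hypothesis
  \<open>D\<close> costs a bounded number of steps; so every line \<open>F\<close> of a derivation can be replaced by
  \<open>D \<supset> F\<close>. The nested implication follows from the right-associated conjunction by exporting one
  conjunct at a time, since \<open>A \<supset> (A \<supset> sq A)\<close> is provable. All bounds are uniform because a
  derivation of a schema in propositional variables can be instantiated line by line.
\<close>

section \<open>Derived schemas\<close>

inductive HLuk_derivable :: "'v fm set \<Rightarrow> 'v fm \<Rightarrow> bool"  (infix \<open>\<turnstile>\<close> 50)
  for \<Gamma> :: "'v fm set" where
  ax: "HLuk_axiom A \<Longrightarrow> \<Gamma> \<turnstile> A"
| hyp: "A \<in> \<Gamma> \<Longrightarrow> \<Gamma> \<turnstile> A"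
| mp: "\<Gamma> \<turnstile> A \<^bold>\<supset> B \<Longrightarrow> \<Gamma> \<turnstile> A \<Longrightarrow> \<Gamma> \<turnstile> B"

lemmas derivable_axioms = HLuk_axiom.intros[THEN HLuk_derivable.ax]

abbreviation sq :: "'v fm \<Rightarrow> 'v fm" where
  "sq A \<equiv> \<^bold>\<not> (A \<^bold>\<supset> \<^bold>\<not> A)"

abbreviation excluded_middle :: "'v fm \<Rightarrow> 'v fm" where
  "excluded_middle A \<equiv> A \<^bold>\<or> \<^bold>\<not> A"

section \<open>Implication without contraction\<close>

lemma impl_trans: "\<Gamma> \<turnstile> A \<^bold>\<supset> B \<Longrightarrow> \<Gamma> \<turnstile> B \<^bold>\<supset> C \<Longrightarrow> \<Gamma> \<turnstile> A \<^bold>\<supset> C"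
  by (meson mp derivable_axioms(2))

text \<open>Axiom 1 weakens \<open>A\<close> to \<open>(B \<supset> A) \<supset> A\<close>, and
  axiom 3 commutes this form of disjunction.\<close>

lemma impl_assertion: "\<Gamma> \<turnstile> A \<^bold>\<supset> (A \<^bold>\<supset> B) \<^bold>\<supset> B"
  by (rule impl_trans[OF derivable_axioms(1) derivable_axioms(3)])

lemma impl_exchange:
  assumes "\<Gamma> \<turnstile> A \<^bold>\<supset> B \<^bold>\<supset> C"
  shows "\<Gamma> \<turnstile> B \<^bold>\<supset> A \<^bold>\<supset> C"
  using impl_trans[OF impl_assertion mp[OF derivable_axioms(2) assms]] .

lemma impl_refl: "\<Gamma> \<turnstile> A \<^bold>\<supset> A"
  by (rule mp[OF impl_exchange[OF derivable_axioms(1)] derivable_axioms(1)])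

lemma impl_prefix: "\<Gamma> \<turnstile> (B \<^bold>\<supset> C) \<^bold>\<supset> (A \<^bold>\<supset> B) \<^bold>\<supset> (A \<^bold>\<supset> C)"
  by (rule impl_exchange[OF derivable_axioms(2)])

lemma impl_mono: "\<Gamma> \<turnstile> B \<^bold>\<supset> C \<Longrightarrow> \<Gamma> \<turnstile> (A \<^bold>\<supset> B) \<^bold>\<supset> (A \<^bold>\<supset> C)"
  by (rule mp[OF impl_prefix])

lemma impl_antimono: "\<Gamma> \<turnstile> A \<^bold>\<supset> B \<Longrightarrow> \<Gamma> \<turnstile> (B \<^bold>\<supset> C) \<^bold>\<supset> (A \<^bold>\<supset> C)"
  by (rule mp[OF derivable_axioms(2)])

section \<open>Negation\<close>

lemma neg_explosion: "\<Gamma> \<turnstile> \<^bold>\<not> A \<^bold>\<supset> A \<^bold>\<supset> B"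
  by (rule impl_trans[OF derivable_axioms(1) derivable_axioms(11)])

text \<open>For a theorem \<open>T\<close>, the formula \<open>\<not> T\<close> serves as falsum:
  axiom 11 with its premises exchanged turns a refutation of \<open>\<not> A\<close> into
  \<open>A\<close>.\<close>

lemma derivable_of_neg_impl_neg:
  "\<Gamma> \<turnstile> T \<Longrightarrow> \<Gamma> \<turnstile> (\<^bold>\<not> A \<^bold>\<supset> \<^bold>\<not> T) \<^bold>\<supset> A"
  by (rule mp[OF impl_exchange[OF derivable_axioms(11)]])

lemma neg_neg_elim: "\<Gamma> \<turnstile> \<^bold>\<not> \<^bold>\<not> A \<^bold>\<supset> A"
  by (rule impl_trans[OF neg_explosion derivable_of_neg_impl_neg[OF impl_refl]])

lemma neg_neg_intro: "\<Gamma> \<turnstile> A \<^bold>\<supset> \<^bold>\<not> \<^bold>\<not> A"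
  by (rule mp[OF derivable_axioms(11) neg_neg_elim])

lemma contraposition: "\<Gamma> \<turnstile> (A \<^bold>\<supset> B) \<^bold>\<supset> (\<^bold>\<not> B \<^bold>\<supset> \<^bold>\<not> A)"
  by (rule impl_trans[OF impl_antimono[OF neg_neg_elim]
        impl_trans[OF impl_mono[OF neg_neg_intro] derivable_axioms(11)]])

section \<open>Conjunction, disjunction and excluded middle\<close>

lemma disj_elim:
  "\<Gamma> \<turnstile> A \<^bold>\<or> B \<Longrightarrow> \<Gamma> \<turnstile> A \<^bold>\<supset> C \<Longrightarrow> \<Gamma> \<turnstile> B \<^bold>\<supset> C \<Longrightarrow> \<Gamma> \<turnstile> C"
  by (meson mp derivable_axioms(10))

lemma conj_pair: "\<Gamma> \<turnstile> A \<^bold>\<supset> B \<^bold>\<supset> (A \<^bold>\<and> B)"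
  by (rule impl_trans[OF derivable_axioms(1)
        mp[OF impl_exchange[OF derivable_axioms(7)] impl_refl]])

text \<open>\<open>(A \<supset> B) \<supset> B\<close> is monotone in \<open>A\<close>, so
  \<open>A\<close> may be weakened to \<open>A \<or> B\<close>. After commuting by axiom 3, the
  remaining premise is axiom 9.\<close>

lemma disj_of_impl_impl: "\<Gamma> \<turnstile> ((A \<^bold>\<supset> B) \<^bold>\<supset> B) \<^bold>\<supset> (A \<^bold>\<or> B)"
proof -
  let ?V = "A \<^bold>\<or> B"
  have "\<Gamma> \<turnstile> ((A \<^bold>\<supset> B) \<^bold>\<supset> B) \<^bold>\<supset> ((?V \<^bold>\<supset> B) \<^bold>\<supset> B)"
    by (intro impl_antimono derivable_axioms(8))
  then have "\<Gamma> \<turnstile> ((A \<^bold>\<supset> B) \<^bold>\<supset> B) \<^bold>\<supset> ((B \<^bold>\<supset> ?V) \<^bold>\<supset> ?V)"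
    by (rule impl_trans[OF _ derivable_axioms(3)])
  from mp[OF impl_exchange[OF this] derivable_axioms(9)] show ?thesis .
qed

text \<open>Contraction fails for a \<open>D\<close> of middle value. Once \<open>D\<close> is
  decided, the positive case is the assumption and the negative one is explosion.\<close>

lemma contraction:
  assumes "\<Gamma> \<turnstile> excluded_middle D" and "\<Gamma> \<turnstile> D \<^bold>\<supset> D \<^bold>\<supset> A"
  shows "\<Gamma> \<turnstile> D \<^bold>\<supset> A"
  by (rule disj_elim[OF assms(1) assms(2) neg_explosion])

lemma mp_under:
  assumes "\<Gamma> \<turnstile> excluded_middle D" and "\<Gamma> \<turnstile> D \<^bold>\<supset> A" and "\<Gamma> \<turnstile> D \<^bold>\<supset> A \<^bold>\<supset> B"
  shows "\<Gamma> \<turnstile> D \<^bold>\<supset> B"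
  by (rule contraction[OF assms(1) impl_trans[OF assms(3) impl_antimono[OF assms(2)]]])

lemma excluded_middle_conj:
  assumes "\<Gamma> \<turnstile> excluded_middle A" and "\<Gamma> \<turnstile> excluded_middle B"
  shows "\<Gamma> \<turnstile> excluded_middle (A \<^bold>\<and> B)"
proof -
  let ?X = "excluded_middle (A \<^bold>\<and> B)"
  have nA: "\<Gamma> \<turnstile> \<^bold>\<not> A \<^bold>\<supset> ?X"
    by (rule impl_trans[OF mp[OF contraposition derivable_axioms(5)] derivable_axioms(9)])
  have nB: "\<Gamma> \<turnstile> \<^bold>\<not> B \<^bold>\<supset> ?X"
    by (rule impl_trans[OF mp[OF contraposition derivable_axioms(6)] derivable_axioms(9)])
  have "\<Gamma> \<turnstile> A \<^bold>\<supset> B \<^bold>\<supset> ?X"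
    by (rule impl_trans[OF conj_pair impl_mono[OF derivable_axioms(8)]])
  \<comment> \<open>\<open>B\<close> is moved outermost so that it can be decided while
    \<open>A\<close> remains an antecedent.\<close>
  then have "\<Gamma> \<turnstile> B \<^bold>\<supset> A \<^bold>\<supset> ?X"
    by (rule impl_exchange)
  moreover have "\<Gamma> \<turnstile> \<^bold>\<not> B \<^bold>\<supset> A \<^bold>\<supset> ?X"
    by (rule impl_trans[OF nB derivable_axioms(1)])
  ultimately have "\<Gamma> \<turnstile> A \<^bold>\<supset> ?X"
    by (rule disj_elim[OF assms(2)])
  then show ?thesis
    by (rule disj_elim[OF assms(1) _ nA])
qed

section \<open>The two-valued formulas \<open>sq A\<close>\<close>

lemma sq_intro: "\<Gamma> \<turnstile> A \<^bold>\<supset> A \<^bold>\<supset> sq A"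
proof -
  \<comment> \<open>One copy of \<open>A\<close> reduces \<open>A \<supset> \<not> A\<close> to
    \<open>\<not> A\<close>; the other, as \<open>\<not> \<not> A\<close>, excludes that. A single
    copy does not suffice: at the middle value of \<open>A\<close>, \<open>sq A\<close> is
    0.\<close>
  have "\<Gamma> \<turnstile> A \<^bold>\<supset> \<^bold>\<not> \<^bold>\<not> A \<^bold>\<supset> sq A"
    by (rule impl_trans[OF impl_assertion contraposition])
  then show ?thesis
    by (rule impl_trans[OF _ impl_antimono[OF neg_neg_intro]])
qed

lemma sq_elim: "\<Gamma> \<turnstile> sq A \<^bold>\<supset> A"
  by (rule impl_trans[OF mp[OF contraposition derivable_axioms(1)] neg_neg_elim])

text \<open>
  Reading \<open>(P \<supset> Q) \<supset> Q\<close> as \<open>P \<or> Q\<close>, axiom 4 says \<open>A \<or> (A \<supset> B) \<or> (B \<supset> C)\<close>; for \<open>B = \<not>A\<close> and \<open>C\<close>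
  refutable, its last disjunct is equivalent to \<open>A\<close>.
\<close>
lemma disj_impl_neg: "\<Gamma> \<turnstile> (A \<^bold>\<supset> \<^bold>\<not> A) \<^bold>\<or> A"
proof -
  let ?E = "A \<^bold>\<supset> \<^bold>\<not> A" and ?T = "A \<^bold>\<supset> A"
  let ?Y = "(?E \<^bold>\<supset> A) \<^bold>\<supset> A" and ?Z = "\<^bold>\<not> A \<^bold>\<supset> \<^bold>\<not> ?T"
  have "\<Gamma> \<turnstile> (?E \<^bold>\<supset> A) \<^bold>\<supset> ?Y \<^bold>\<supset> A"
    by (rule impl_assertion)
  moreover have "\<Gamma> \<turnstile> (?Y \<^bold>\<supset> A) \<^bold>\<supset> ?Y \<^bold>\<supset> ?Z"
    by (rule impl_mono[OF impl_exchange[OF neg_explosion]])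
  ultimately have "\<Gamma> \<turnstile> (?E \<^bold>\<supset> A) \<^bold>\<supset> ?Y \<^bold>\<supset> ?Z"
    by (rule impl_trans)
  then have "\<Gamma> \<turnstile> (?E \<^bold>\<supset> A) \<^bold>\<supset> ?Z"
    by (rule impl_trans[OF _ derivable_axioms(4)])
  then have "\<Gamma> \<turnstile> (?E \<^bold>\<supset> A) \<^bold>\<supset> A"
    by (rule impl_trans[OF _ derivable_of_neg_impl_neg[OF impl_refl]])
  then show ?thesis
    by (rule mp[OF disj_of_impl_impl])
qed

lemma excluded_middle_sq: "\<Gamma> \<turnstile> excluded_middle (sq A)"
proof -
  let ?E = "A \<^bold>\<supset> \<^bold>\<not> A" and ?X = "excluded_middle (sq A)"
  have EX: "\<Gamma> \<turnstile> ?E \<^bold>\<supset> ?X"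
    by (rule impl_trans[OF neg_neg_intro derivable_axioms(9)])
  have "\<Gamma> \<turnstile> A \<^bold>\<supset> A \<^bold>\<supset> ?X"
    by (rule impl_trans[OF sq_intro impl_mono[OF derivable_axioms(8)]])
  \<comment> \<open>Reaching \<open>sq A\<close> consumes \<open>A\<close> twice, so the case split
    is made twice: here below the antecedent \<open>A\<close>, then at top level.\<close>
  with impl_trans[OF EX derivable_axioms(1)] have "\<Gamma> \<turnstile> A \<^bold>\<supset> ?X"
    by (rule disj_elim[OF disj_impl_neg])
  with EX show ?thesis
    by (rule disj_elim[OF disj_impl_neg])
qed

section \<open>Exporting conjuncts\<close>

lemma impl_prefix2: "\<Gamma> \<turnstile> (B \<^bold>\<supset> C) \<^bold>\<supset> (A \<^bold>\<supset> A' \<^bold>\<supset> B) \<^bold>\<supset> (A \<^bold>\<supset> A' \<^bold>\<supset> C)"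
  by (rule impl_trans[OF impl_prefix impl_prefix])

lemma export_sq: "\<Gamma> \<turnstile> (sq A \<^bold>\<supset> B) \<^bold>\<supset> A \<^bold>\<supset> A \<^bold>\<supset> B"
  by (rule mp[OF impl_exchange[OF impl_prefix2] sq_intro])

text \<open>Inductive step towards \<open>double_impl\<close>: \<open>C\<close> stands for what
  \<open>D \<supset> B\<close> has already been exported to.\<close>

lemma export_sq_conj:
  assumes "\<Gamma> \<turnstile> (D \<^bold>\<supset> B) \<^bold>\<supset> C"
  shows "\<Gamma> \<turnstile> ((sq A \<^bold>\<and> D) \<^bold>\<supset> B) \<^bold>\<supset> A \<^bold>\<supset> A \<^bold>\<supset> C"
proof -
  let ?X = "sq A \<^bold>\<and> D"
  have "\<Gamma> \<turnstile> A \<^bold>\<supset> A \<^bold>\<supset> D \<^bold>\<supset> ?X"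
    by (rule mp[OF export_sq conj_pair])
  then have "\<Gamma> \<turnstile> (?X \<^bold>\<supset> B) \<^bold>\<supset> A \<^bold>\<supset> A \<^bold>\<supset> D \<^bold>\<supset> B"
    by (rule mp[OF impl_exchange[OF impl_trans[OF impl_prefix impl_prefix2]]])
  then show ?thesis
    by (rule impl_trans[OF _ impl_mono[OF impl_mono[OF assms]]])
qed

section \<open>Counting steps\<close>

text \<open>
  \<open>derives_within S k G\<close>: a sequence whose lines include \<open>S\<close> can be extended by at most \<open>k\<close> lines
  so as to include \<open>G\<close>. Several conclusions are allowed because derivations share lines.
\<close>
inductive derives_within :: "'v fm set \<Rightarrow> nat \<Rightarrow> 'v fm set \<Rightarrow> bool" where
  base: "G \<subseteq> S \<Longrightarrow> derives_within S k G"
| ax: "HLuk_axiom A \<Longrightarrow> derives_within (insert A S) k G \<Longrightarrow> derives_within S (Suc k) G"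
| mp: "A \<in> S \<Longrightarrow> A \<^bold>\<supset> B \<in> S \<Longrightarrow> derives_within (insert B S) k G \<Longrightarrow> derives_within S (Suc k) G"

lemma derives_within_mono:
  "derives_within S k G \<Longrightarrow> S \<subseteq> S' \<Longrightarrow> k \<le> k' \<Longrightarrow> G' \<subseteq> G \<Longrightarrow> derives_within S' k' G'"
proof (induction arbitrary: S' k' rule: derives_within.induct)
  case (base G S k)
  then show ?case by (intro derives_within.base) auto
next
  case (ax A S k G)
  then obtain l where l: "k' = Suc l" "k \<le> l" by (cases k') auto
  from ax.prems l have "derives_within (insert A S') l G'"
    by (intro ax.IH) auto
  with ax.hyps(1) show ?case unfolding l(1) by (rule derives_within.ax)
next
  case (mp A S B k G)
  then obtain l where l: "k' = Suc l" "k \<le> l" by (cases k') auto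
  from mp.prems l have "derives_within (insert B S') l G'"
    by (intro mp.IH) auto
  with mp.hyps(1,2) mp.prems(1) show ?case
    unfolding l(1) by (intro derives_within.mp[of A _ B]) auto
qed

lemma derives_within_cut:
  "derives_within S k G \<Longrightarrow> derives_within (S \<union> G) l H \<Longrightarrow> derives_within S (k + l) (G \<union> H)"
proof (induction rule: derives_within.induct)
  case (base G S k)
  \<comment> \<open>Lines are never discarded, so everything available at the start may be added to
    the goal; the inner induction is on the second derivation.\<close>
  have "derives_within (S \<union> G) l (S \<union> G \<union> H)"
    using base.prems
  proof (induction rule: derives_within.induct)
    case (ax A S k G)
    have "derives_within (insert A S) k (S \<union> G)"
      using ax.IH by (rule derives_within_mono) auto
    with ax.hyps(1) show ?case by (rule derives_within.ax)
  next
    case (mp A S B k G)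
    have "derives_within (insert B S) k (S \<union> G)"
      using mp.IH by (rule derives_within_mono) auto
    with mp.hyps(1,2) show ?case by (rule derives_within.mp)
  qed (auto intro: derives_within.base)
  then show ?case
    by (rule derives_within_mono) (use base.hyps in auto)
next
  case (ax A S k G)
  have "derives_within (insert A S \<union> G) l H"
    using ax.prems by (rule derives_within_mono) auto
  from derives_within.ax[OF ax.hyps(1) ax.IH[OF this]] show ?case by simp
next
  case (mp A S B k G)
  have "derives_within (insert B S \<union> G) l H"
    using mp.prems by (rule derives_within_mono) auto
  from derives_within.mp[OF mp.hyps(1,2) mp.IH[OF this]] show ?case by simp
qed

lemma derives_within_trans:
  assumes "derives_within S k G" and "derives_within G l H"
  shows "derives_within S (k + l) H"
  using derives_within_cut[OF assms(1) derives_within_mono[OF assms(2)]]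
  by (rule derives_within_mono) auto

lemma derives_within_Un:
  assumes "derives_within S k G" and "derives_within S l H"
  shows "derives_within S (k + l) (G \<union> H)"
  by (rule derives_within_cut[OF assms(1) derives_within_mono[OF assms(2)]]) auto

section \<open>From step counts to actual sequences\<close>

definition derivation_lines :: "'v fm set \<Rightarrow> 'v fm list \<Rightarrow> bool" where
  "derivation_lines \<Gamma> d \<longleftrightarrow>
     (\<forall>i < length d. HLuk_axiom (d ! i) \<or> d ! i \<in> \<Gamma> \<or>
        (\<exists>j < i. \<exists>k < i. d ! k = (d ! j \<^bold>\<supset> d ! i)))"

text \<open>Earlier lines refer only to positions within \<open>d\<close>, and the new line may use
  all of \<open>d\<close>, so positions reduce to membership.\<close>

lemma derivation_lines_snoc:
  "derivation_lines \<Gamma> (d @ [A]) \<longleftrightarrow> derivation_lines \<Gamma> d \<and>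
     (HLuk_axiom A \<or> A \<in> \<Gamma> \<or> (\<exists>B \<in> set d. B \<^bold>\<supset> A \<in> set d))"
proof -
  have "(\<exists>j < length d. \<exists>k < length d. d ! k = (d ! j \<^bold>\<supset> A)) \<longleftrightarrow> (\<exists>B \<in> set d. B \<^bold>\<supset> A \<in> set d)"
    by (metis in_set_conv_nth)
  moreover have "(\<exists>j < i. \<exists>k < i. (d @ [A]) ! k = ((d @ [A]) ! j \<^bold>\<supset> C)) \<longleftrightarrow>
      (\<exists>j < i. \<exists>k < i. d ! k = (d ! j \<^bold>\<supset> C))" if "i \<le> length d" for i C
    using that by (intro ex_cong1 conj_cong refl) (simp add: nth_append)
  ultimately show ?thesis
    by (auto simp: derivation_lines_def All_less_Suc nth_append)
qed

lemma derivation_lines_take: "derivation_lines \<Gamma> d \<Longrightarrow> derivation_lines \<Gamma> (take l d)"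
  by (auto simp: derivation_lines_def)

lemma derives_within_lines:
  "derives_within S k G \<Longrightarrow> derivation_lines {} p \<Longrightarrow> S \<subseteq> set p \<Longrightarrow>
     \<exists>q. derivation_lines {} q \<and> length q \<le> length p + k \<and> G \<subseteq> set q"
proof (induction arbitrary: p rule: derives_within.induct)
  case (base G S k)
  then show ?case by (intro exI[of _ p]) auto
next
  case (ax A S k G)
  have "derivation_lines {} (p @ [A])" "insert A S \<subseteq> set (p @ [A])"
    using ax by (auto simp: derivation_lines_snoc)
  from ax.IH[OF this] show ?case by simp
next
  case (mp A S B k G)
  have "derivation_lines {} (p @ [B])" "insert B S \<subseteq> set (p @ [B])"
    using mp by (auto simp: derivation_lines_snoc)
  from mp.IH[OF this] show ?case by simp
qed

lemma HLuk_proof_of_derives_within: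
  assumes "derives_within {} k {A}"
  shows "\<exists>p. HLuk_proof p A \<and> length p \<le> k"
proof -
  have "derivation_lines {} []" by (simp add: derivation_lines_def)
  from derives_within_lines[OF assms this]
  obtain q where q: "derivation_lines {} q" "length q \<le> k" "A \<in> set q" by auto
  then obtain i where i: "i < length q" "q ! i = A" by (auto simp: in_set_conv_nth)
  \<comment> \<open>\<open>A\<close> need not be the last line of \<open>q\<close>; cutting just
    after its position makes it so.\<close>
  have "HLuk_proof (take (Suc i) q) A"
    using derivation_lines_take[OF q(1), of "Suc i"] i
    by (auto simp: HLuk_proof_def HLuk_derivation_def derivation_lines_def take_Suc_conv_app_nth)
  moreover have "length (take (Suc i) q) \<le> k" using q(2) by simp
  ultimately show ?thesis by blast
qed

section \<open>Instantiating schemas\<close>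

primrec fm_subst :: "('v \<Rightarrow> 'w fm) \<Rightarrow> 'v fm \<Rightarrow> 'w fm" where
  "fm_subst \<sigma> (Var x) = \<sigma> x"
| "fm_subst \<sigma> (\<^bold>\<not> A) = \<^bold>\<not> fm_subst \<sigma> A"
| "fm_subst \<sigma> (A \<^bold>\<and> B) = fm_subst \<sigma> A \<^bold>\<and> fm_subst \<sigma> B"
| "fm_subst \<sigma> (A \<^bold>\<or> B) = fm_subst \<sigma> A \<^bold>\<or> fm_subst \<sigma> B"
| "fm_subst \<sigma> (A \<^bold>\<supset> B) = fm_subst \<sigma> A \<^bold>\<supset> fm_subst \<sigma> B"

lemma HLuk_axiom_subst: "HLuk_axiom A \<Longrightarrow> HLuk_axiom (fm_subst \<sigma> A)"
  by (induction rule: HLuk_axiom.induct) (simp_all add: HLuk_axiom.intros)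

lemma derives_within_subst:
  "derives_within S k G \<Longrightarrow> derives_within (fm_subst \<sigma> ` S) k (fm_subst \<sigma> ` G)"
proof (induction rule: derives_within.induct)
  case (base G S k)
  then show ?case by (intro derives_within.base) auto
next
  case (ax A S k G)
  from derives_within.ax[OF HLuk_axiom_subst[OF ax.hyps(1)]] ax.IH show ?case by simp
next
  case (mp A S B k G)
  then show ?case
    by (intro derives_within.mp[of "fm_subst \<sigma> A" _ "fm_subst \<sigma> B"])
       (auto simp flip: fm_subst.simps(5))
qed

lemma derives_within_of_derivable: "\<Gamma> \<turnstile> A \<Longrightarrow> \<exists>k. derives_within \<Gamma> k {A}"
proof (induction rule: HLuk_derivable.induct)
  case (ax A)
  then have "derives_within \<Gamma> (Suc 0) {A}"
    by (auto intro: derives_within.intros)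
  then show ?case ..
next
  case (hyp A)
  then show ?case by (auto intro: derives_within.base)
next
  case (mp A B)
  then obtain k l where "derives_within \<Gamma> k {A \<^bold>\<supset> B}" "derives_within \<Gamma> l {A}" by blast
  then have "derives_within \<Gamma> (k + l) {A \<^bold>\<supset> B, A}"
    using derives_within_Un by fastforce
  moreover have "derives_within {A \<^bold>\<supset> B, A} 1 {B}"
    by (auto intro: derives_within.intros)
  ultimately show ?case by (blast intro: derives_within_trans)
qed

text \<open>The bound \<open>k\<close> comes from one derivation in variables, before
  \<open>\<sigma>\<close> is chosen. Stating it for all large \<open>K\<close> lets finitely many
  bounds be merged.\<close>

lemma uniform_bound:
  assumes "\<Gamma> \<turnstile> (A :: 'v fm)"
  shows "\<forall>\<^sub>F K in sequentially.
    \<forall>\<sigma> :: 'v \<Rightarrow> 'w fm. derives_within (fm_subst \<sigma> ` \<Gamma>) K {fm_subst \<sigma> A}"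
proof -
  from derives_within_of_derivable[OF assms] obtain k where k: "derives_within \<Gamma> k {A}" ..
  have "\<forall>\<sigma> :: 'v \<Rightarrow> 'w fm. derives_within (fm_subst \<sigma> ` \<Gamma>) K {fm_subst \<sigma> A}" if "K \<ge> k" for K
    by (intro allI derives_within_mono[OF derives_within_subst[OF k]] that) auto
  then show ?thesis by (rule eventually_sequentiallyI)
qed

text \<open>The three lines are \<open>A\<close>, \<open>A \<supset> (D \<supset> A)\<close> and
  \<open>D \<supset> A\<close>.\<close>

lemma axiom_under: "HLuk_axiom A \<Longrightarrow> derives_within {} 3 {D \<^bold>\<supset> A}"
  unfolding numeral_3_eq_3
  by (rule derives_within.ax, assumption, rule derives_within.ax, rule ax1[of A D],
      rule derives_within.mp[of A _ "D \<^bold>\<supset> A"])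
     (auto intro: derives_within.base)

section \<open>Simulating derivations\<close>

text \<open>One constant serves all schemas used in the simulation, independently of the size of the
  formulas substituted.\<close>

locale uniform_bounds =
  fixes K :: nat
  assumes K_ge: "K \<ge> 3"
    and refl_bound: "derives_within {} K {A \<^bold>\<supset> A :: 'v fm}"
    and mp_bound:
      "derives_within {excluded_middle D, D \<^bold>\<supset> A, D \<^bold>\<supset> A \<^bold>\<supset> B} K {D \<^bold>\<supset> B :: 'v fm}"
    and excluded_middle_sq_bound: "derives_within {} K {excluded_middle (sq A) :: 'v fm}"
    and excluded_middle_conj_bound:
      "derives_within {excluded_middle A, excluded_middle B} K {excluded_middle (A \<^bold>\<and> B) :: 'v fm}"
    and sq_elim_bound: "derives_within {D \<^bold>\<supset> sq A} K {D \<^bold>\<supset> A :: 'v fm}"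
    and conj_elim1_bound: "derives_within {D \<^bold>\<supset> A \<^bold>\<and> B} K {D \<^bold>\<supset> A :: 'v fm}"
    and conj_elim2_bound: "derives_within {D \<^bold>\<supset> A \<^bold>\<and> B} K {D \<^bold>\<supset> B :: 'v fm}"
    and export_sq_bound: "derives_within {} K {(sq A \<^bold>\<supset> B) \<^bold>\<supset> A \<^bold>\<supset> A \<^bold>\<supset> B :: 'v fm}"
    and export_sq_conj_bound:
      "derives_within {(D \<^bold>\<supset> B) \<^bold>\<supset> C} K {((sq A \<^bold>\<and> D) \<^bold>\<supset> B) \<^bold>\<supset> A \<^bold>\<supset> A \<^bold>\<supset> C :: 'v fm}"
begin

text \<open>However it is parenthesized, a conjunction of \<open>m\<close> formulas has
  \<open>m - 1\<close> inner nodes; at \<open>K\<close> lines per leaf and per node this makes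
  \<open>(2 * m - 1) * K\<close>. The summand \<open>K\<close> on the left avoids
  subtraction.\<close>

lemma excluded_middle_assoc_conj:
  fixes D :: "'v fm"
  assumes "assoc_conj Cs D" and "set Cs \<subseteq> range sq"
  shows "\<exists>k. derives_within {} k {excluded_middle D} \<and> k + K \<le> 2 * K * length Cs"
  using assms
proof (induction rule: assoc_conj.induct)
  case (single C)
  then show ?case using excluded_middle_sq_bound by (intro exI[of _ K]) auto
next
  case (conj Cs C Ds D)
  then obtain k l
    where k: "derives_within {} k {excluded_middle C}" "k + K \<le> 2 * K * length Cs"
      and l: "derives_within {} l {excluded_middle D}" "l + K \<le> 2 * K * length Ds"
    by auto
  have "derives_within {} (k + l) {excluded_middle C, excluded_middle D}"
    using derives_within_Un[OF k(1) l(1)] by (simp add: insert_commute)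
  from derives_within_trans[OF this excluded_middle_conj_bound] k(2) l(2)
  show ?case by (intro exI[of _ "k + l + K"]) (simp add: algebra_simps)
qed

text \<open>Every subconjunction is extracted only once, which keeps the cost linear:
  \<open>K\<close> per leaf and \<open>2 * K\<close> per inner node. The antecedent \<open>X\<close>
  stays fixed while the induction descends into \<open>D\<close>.\<close>

lemma assoc_conj_elim:
  fixes D :: "'v fm"
  assumes "assoc_conj Cs D"
  shows "\<exists>k. derives_within {X \<^bold>\<supset> D} k {X \<^bold>\<supset> A |A. sq A \<in> set Cs} \<and> k + 2 * K \<le> 3 * K * length Cs"
  using assms
proof (induction rule: assoc_conj.induct)
  case (single C)
  have "derives_within {X \<^bold>\<supset> C} K {X \<^bold>\<supset> A |A. sq A \<in> {C}}"
  \<comment> \<open>If \<open>C\<close> is not of the form \<open>sq A\<close>, the goal set is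
    empty.\<close>
  proof (cases "\<exists>A. C = sq A")
    case True
    then obtain A where "C = sq A" ..
    then show ?thesis by (intro derives_within_mono[OF sq_elim_bound[of X A]]) auto
  qed (auto intro: derives_within.base)
  then show ?case by (intro exI[of _ K]) auto
next
  case (conj Cs C Ds D)
  let ?G = "{X \<^bold>\<supset> C, X \<^bold>\<supset> D}"
  let ?P = "\<lambda>Cs. {X \<^bold>\<supset> A |A. sq A \<in> set Cs}"
  from conj obtain k l
    where k: "derives_within {X \<^bold>\<supset> C} k (?P Cs)" "k + 2 * K \<le> 3 * K * length Cs"
      and l: "derives_within {X \<^bold>\<supset> D} l (?P Ds)" "l + 2 * K \<le> 3 * K * length Ds"
    by auto
  have "derives_within ?G (k + l) (?P Cs \<union> ?P Ds)"
    by (intro derives_within_Un; rule derives_within_mono[OF k(1)] derives_within_mono[OF l(1)])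
       auto
  moreover have "derives_within {X \<^bold>\<supset> C \<^bold>\<and> D} (K + K) ?G"
    using derives_within_Un[OF conj_elim1_bound[of X C D] conj_elim2_bound[of X C D]]
    by (simp add: insert_commute)
  ultimately have "derives_within {X \<^bold>\<supset> C \<^bold>\<and> D} (K + K + (k + l)) (?P Cs \<union> ?P Ds)"
    by (rule derives_within_trans[rotated])
  then have "derives_within {X \<^bold>\<supset> C \<^bold>\<and> D} (K + K + (k + l)) (?P (Cs @ Ds))"
    by (rule derives_within_mono) auto
  with k(2) l(2) show ?case
    by (intro exI[of _ "K + K + (k + l)"]) (simp add: algebra_simps)
qed

text \<open>Prefixing each line with \<open>D\<close> costs at most \<open>K\<close> lines: axioms
  are weakened, hypotheses are available from the start, and modus ponens becomes
  \<open>mp_bound\<close>.\<close>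

lemma lines_under:
  fixes D :: "'v fm"
  assumes "derivation_lines \<Gamma> d"
  shows "derives_within (insert (excluded_middle D) ((\<lambda>A. D \<^bold>\<supset> A) ` \<Gamma>)) (K * length d)
           ((\<lambda>A. D \<^bold>\<supset> A) ` set d)"
  using assms
proof (induction d rule: rev_induct)
  case Nil
  show ?case by (auto intro: derives_within.base)
next
  case (snoc A d)
  let ?S = "insert (excluded_middle D) ((\<lambda>A. D \<^bold>\<supset> A) ` \<Gamma>)"
  let ?G = "(\<lambda>A. D \<^bold>\<supset> A) ` set d"
  from snoc have IH: "derives_within ?S (K * length d) ?G"
    by (simp add: derivation_lines_snoc)
  from snoc.prems consider "HLuk_axiom A" | "A \<in> \<Gamma>"
    | B where "B \<in> set d" "B \<^bold>\<supset> A \<in> set d"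
    by (auto simp: derivation_lines_snoc)
  then have "derives_within (?S \<union> ?G) K {D \<^bold>\<supset> A}"
  proof cases
    case 1
    then show ?thesis by (intro derives_within_mono[OF axiom_under] K_ge) auto
  next
    case 2
    then show ?thesis by (auto intro: derives_within.base)
  next
    case 3
    then show ?thesis by (intro derives_within_mono[OF mp_bound[of D B A]]) auto
  qed
  from derives_within_cut[OF IH this] show ?case
    by (simp add: algebra_simps)
qed

lemma deduction_conj:
  fixes D :: "'v fm"
  assumes "derivation_lines (set As) d" and "B \<in> set d" and D: "assoc_conj (map sq As) D"
  shows "derives_within {} (5 * K * (length As + length d)) {D \<^bold>\<supset> B}"
proof -
  let ?m = "length As" and ?H = "(\<lambda>A. D \<^bold>\<supset> A) ` set As"
  from excluded_middle_assoc_conj[OF D] obtain k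
    where k: "derives_within {} k {excluded_middle D}" "k + K \<le> 2 * K * ?m" by auto
  \<comment> \<open>With \<open>X\<close> taken to be \<open>D\<close> itself, the extraction starts
    from the theorem \<open>D \<supset> D\<close>.\<close>
  from assoc_conj_elim[OF D, of D] obtain l
    where l: "derives_within {D \<^bold>\<supset> D} l {D \<^bold>\<supset> A |A. sq A \<in> set (map sq As)}"
      "l + 2 * K \<le> 3 * K * ?m" by auto
  have "derives_within {D \<^bold>\<supset> D} l ?H"
    using l(1) by (rule derives_within_mono) auto
  from derives_within_Un[OF k(1) derives_within_trans[OF refl_bound this]]
  have "derives_within {} (k + (K + l)) (insert (excluded_middle D) ?H)" by simp
  \<comment> \<open>The total is at most
    \<open>(2 * m - 1) * K + K + (3 * m - 2) * K + K * n\<close>, where \<open>n\<close> is the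
    length of \<open>d\<close>.\<close>
  from derives_within_trans[OF this lines_under[OF assms(1)]]
  show ?thesis
    by (rule derives_within_mono) (use assms(2) k(2) l(2) in \<open>auto simp: algebra_simps\<close>)
qed

text \<open>The witness is the right-associated conjunction, so that each step peels off the first
  conjunct at cost \<open>K\<close>.\<close>

lemma export_double_impl:
  fixes B :: "'v fm"
  assumes "As \<noteq> []"
  shows "\<exists>D. assoc_conj (map sq As) D \<and>
           derives_within {} (K * length As) {(D \<^bold>\<supset> B) \<^bold>\<supset> double_impl As B}"
  using assms
proof (induction As rule: list_nonempty_induct)
  case (single A)
  then show ?case using export_sq_bound by (auto intro: assoc_conj.single)
next
  case (cons A As)
  then obtain D where D: "assoc_conj (map sq As) D"
    "derives_within {} (K * length As) {(D \<^bold>\<supset> B) \<^bold>\<supset> double_impl As B}" by blast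
  have "assoc_conj (map sq (A # As)) (sq A \<^bold>\<and> D)"
    using assoc_conj.conj[OF assoc_conj.single D(1)] by simp
  moreover have "derives_within {} (K * length (A # As))
      {((sq A \<^bold>\<and> D) \<^bold>\<supset> B) \<^bold>\<supset> double_impl (A # As) B}"
    using derives_within_trans[OF D(2) export_sq_conj_bound]
    by (rule derives_within_mono) auto
  ultimately show ?case by blast
qed

lemma deduction_double_impl:
  fixes B :: "'v fm"
  assumes "derivation_lines (set As) d" and "B \<in> set d" and "As \<noteq> []"
  shows "derives_within {} (7 * K * (length As + length d)) {double_impl As B}"
proof -
  from export_double_impl[OF assms(3)] obtain D where D: "assoc_conj (map sq As) D"
    "derives_within {} (K * length As) {(D \<^bold>\<supset> B) \<^bold>\<supset> double_impl As B}" by blast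
  let ?P = "double_impl As B"
  have "derives_within {D \<^bold>\<supset> B, (D \<^bold>\<supset> B) \<^bold>\<supset> ?P} 1 {?P}"
    by (auto intro: derives_within.intros)
  moreover have "derives_within {} (5 * K * (length As + length d) + K * length As)
      {D \<^bold>\<supset> B, (D \<^bold>\<supset> B) \<^bold>\<supset> ?P}"
    using derives_within_Un[OF deduction_conj[OF assms(1,2) D(1)] D(2)] by (simp add: insert_commute)
  ultimately have "derives_within {}
      (5 * K * (length As + length d) + K * length As + 1) {?P}"
    by (rule derives_within_trans[rotated])
  \<comment> \<open>This absorbs the final modus ponens; \<open>d\<close> is nonempty because it
    contains \<open>B\<close>.\<close>
  moreover have "1 \<le> K * length d"
    using K_ge assms(2) by (cases d) auto
  then have "5 * K * (length As + length d) + K * length As + 1 \<le> 7 * K * (length As + length d)"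
    unfolding distrib_left mult.assoc by linarith
  ultimately show ?thesis
    by (rule derives_within_mono[OF _ subset_refl _ subset_refl])
qed

end

lemma uniform_bounds_exist: "\<exists>K. uniform_bounds TYPE('v) K"
proof -
  let ?a = "Var 0 :: nat fm" and ?b = "Var 1 :: nat fm"
    and ?c = "Var 2 :: nat fm" and ?d = "Var 3 :: nat fm"
  \<comment> \<open>The schemas mention only the variables 0 to 3, so the unspecified values at
    larger indices are harmless.\<close>
  define \<sigma> :: "'v fm \<Rightarrow> 'v fm \<Rightarrow> 'v fm \<Rightarrow> 'v fm \<Rightarrow> nat \<Rightarrow> 'v fm"
    where "\<sigma> A B C D = (\<lambda>i. [A, B, C, D] ! i)" for A B C D
  have \<sigma>: "\<sigma> A B C D 0 = A" "\<sigma> A B C D (Suc 0) = B" "\<sigma> A B C D 2 = C" "\<sigma> A B C D 3 = D"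
    for A B C D
    by (simp_all add: \<sigma>_def)
  note bound = uniform_bound[where 'v = nat and 'w = 'v]
  have "{} \<turnstile> ?a \<^bold>\<supset> ?a"
    by (rule impl_refl)
  note refl = bound[OF this]
  have "{excluded_middle ?d, ?d \<^bold>\<supset> ?a, ?d \<^bold>\<supset> ?a \<^bold>\<supset> ?b} \<turnstile> ?d \<^bold>\<supset> ?b"
    by (rule mp_under[of _ _ ?a]; rule HLuk_derivable.hyp) simp_all
  note mp = bound[OF this]
  have "{} \<turnstile> excluded_middle (sq ?a)"
    by (rule excluded_middle_sq)
  note em_sq = bound[OF this]
  have "{excluded_middle ?a, excluded_middle ?b} \<turnstile> excluded_middle (?a \<^bold>\<and> ?b)"
    by (rule excluded_middle_conj; rule HLuk_derivable.hyp) simp_all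
  note em_conj = bound[OF this]
  have "{?d \<^bold>\<supset> sq ?a} \<turnstile> ?d \<^bold>\<supset> ?a"
    by (rule impl_trans[OF HLuk_derivable.hyp sq_elim]) simp
  note sq_elim = bound[OF this]
  have "{?d \<^bold>\<supset> ?a \<^bold>\<and> ?b} \<turnstile> ?d \<^bold>\<supset> ?a"
    by (rule impl_trans[OF HLuk_derivable.hyp derivable_axioms(5)]) simp
  note conj_elim1 = bound[OF this]
  have "{?d \<^bold>\<supset> ?a \<^bold>\<and> ?b} \<turnstile> ?d \<^bold>\<supset> ?b"
    by (rule impl_trans[OF HLuk_derivable.hyp derivable_axioms(6)]) simp
  note conj_elim2 = bound[OF this]
  have "{} \<turnstile> (sq ?a \<^bold>\<supset> ?b) \<^bold>\<supset> ?a \<^bold>\<supset> ?a \<^bold>\<supset> ?b"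
    by (rule export_sq)
  note export = bound[OF this]
  have "{(?d \<^bold>\<supset> ?b) \<^bold>\<supset> ?c} \<turnstile> ((sq ?a \<^bold>\<and> ?d) \<^bold>\<supset> ?b) \<^bold>\<supset> ?a \<^bold>\<supset> ?a \<^bold>\<supset> ?c"
    by (rule export_sq_conj, rule HLuk_derivable.hyp) simp
  note export_conj = bound[OF this]
  have "\<forall>\<^sub>F K in sequentially. uniform_bounds TYPE('v) K"
    using refl mp em_sq em_conj sq_elim conj_elim1 conj_elim2 export export_conj
      eventually_ge_at_top[of 3]
  proof eventually_elim
    case (elim K)
    show ?case
    proof
      fix A B C D :: "'v fm"
      show "3 \<le> K" by (rule elim)
      show "derives_within {} K {A \<^bold>\<supset> A}"
        using elim(1)[THEN spec, of "\<sigma> A B C D"] by (simp add: \<sigma>)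
      show "derives_within {excluded_middle D, D \<^bold>\<supset> A, D \<^bold>\<supset> A \<^bold>\<supset> B} K {D \<^bold>\<supset> B}"
        using elim(2)[THEN spec, of "\<sigma> A B C D"] by (simp add: \<sigma>)
      show "derives_within {} K {excluded_middle (sq A)}"
        using elim(3)[THEN spec, of "\<sigma> A B C D"] by (simp add: \<sigma>)
      show "derives_within {excluded_middle A, excluded_middle B} K {excluded_middle (A \<^bold>\<and> B)}"
        using elim(4)[THEN spec, of "\<sigma> A B C D"] by (simp add: \<sigma>)
      show "derives_within {D \<^bold>\<supset> sq A} K {D \<^bold>\<supset> A}"
        using elim(5)[THEN spec, of "\<sigma> A B C D"] by (simp add: \<sigma>)
      show "derives_within {D \<^bold>\<supset> A \<^bold>\<and> B} K {D \<^bold>\<supset> A}"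
        using elim(6)[THEN spec, of "\<sigma> A B C D"] by (simp add: \<sigma>)
      show "derives_within {D \<^bold>\<supset> A \<^bold>\<and> B} K {D \<^bold>\<supset> B}"
        using elim(7)[THEN spec, of "\<sigma> A B C D"] by (simp add: \<sigma>)
      show "derives_within {} K {(sq A \<^bold>\<supset> B) \<^bold>\<supset> A \<^bold>\<supset> A \<^bold>\<supset> B}"
        using elim(8)[THEN spec, of "\<sigma> A B C D"] by (simp add: \<sigma>)
      show "derives_within {(D \<^bold>\<supset> B) \<^bold>\<supset> C} K {((sq A \<^bold>\<and> D) \<^bold>\<supset> B) \<^bold>\<supset> A \<^bold>\<supset> A \<^bold>\<supset> C}"
        using elim(9)[THEN spec, of "\<sigma> A B C D"] by (simp add: \<sigma>)
    qed
  qed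
  then show ?thesis
    using eventually_happens by fastforce
qed

theorem theorem8:
  "\<exists>c::nat. \<forall>(As :: 'v fm list) (B :: 'v fm) (n :: nat).
     (\<exists>d. HLuk_derivation (set As) d B \<and> length d = n) \<longrightarrow>
       (\<exists>p. HLuk_proof p (double_impl As B) \<and> length p \<le> c * (length As + n)) \<and>
       (\<forall>D. assoc_conj (map (\<lambda>A. \<^bold>\<not> (A \<^bold>\<supset> \<^bold>\<not> A)) As) D \<longrightarrow>
          (\<exists>p. HLuk_proof p (D \<^bold>\<supset> B) \<and> length p \<le> c * (length As + n)))"
proof -
  obtain K where "uniform_bounds TYPE('v) K"
    using uniform_bounds_exist by blast
  then interpret uniform_bounds K .
  show ?thesis
  proof (intro exI[of _ "7 * K"] allI impI conjI; elim exE conjE)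
    fix As :: "'v fm list" and B n d
    assume d: "HLuk_derivation (set As) d B" and n: "length d = n"
    then have lines: "derivation_lines (set As) d" "B \<in> set d"
      by (auto simp: HLuk_derivation_def derivation_lines_def)
    show "\<exists>p. HLuk_proof p (double_impl As B) \<and> length p \<le> 7 * K * (length As + n)"
    \<comment> \<open>There is no empty conjunction to export from, but then
      \<open>double_impl As B\<close> is \<open>B\<close> and \<open>d\<close> is already a
      proof.\<close>
    proof (cases "As = []")
      case True
      with d n K_ge show ?thesis
        by (intro exI[of _ d]) (auto simp: HLuk_proof_def)
    next
      case False
      with HLuk_proof_of_derives_within[OF deduction_double_impl[OF lines]] n show ?thesis
        by auto
    qed
    fix D
    assume "assoc_conj (map sq As) D"
    from HLuk_proof_of_derives_within[OF deduction_conj[OF lines this]]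
    obtain p where "HLuk_proof p (D \<^bold>\<supset> B)" "length p \<le> 5 * K * (length As + n)"
      using n by auto
    moreover have "5 * K * (length As + n) \<le> 7 * K * (length As + n)" by simp
    ultimately show "\<exists>p. HLuk_proof p (D \<^bold>\<supset> B) \<and> length p \<le> 7 * K * (length As + n)"
      by (meson order.trans)
  qed
qed

end
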